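(* Let $p$ be a real monic polynomial of degree $k\ge 2$ having exactly $n$ real roots $\alpha_1<\alpha_2<\dots<\alpha_n$, with $1\le n\le k$, all of them simple, and let $S=S_p$ be its secant map. Then $S$ induces a smooth dynamical system on $E_S$. Moreover the following statements hold. (a) The only fixed points of $S$ are the points $(\alpha_\ell,\alpha_\ell)$, $\ell=1,\dots,n$, and they are all attracting. (b) Each basin of attraction $A(\alpha_\ell)$, $\ell=1,\dots,n$, is unbounded. If $n=1$ then $A^\star(\alpha_1)$ is unbounded, and if $n=2$ then $A^\star(\alpha_1)$ and $A^\star(\alpha_2)$ are unbounded. If $n\ge 3$ then $A^\star(\alpha_1)$ and $A^\star(\alpha_n)$ are unbounded, while $A^\star(\alpha_\ell)$ is bounded for every $2\le \ell\le n-1$. (c) Let $Q_{i,j}:=(\alpha_i,\alpha_j)$ for $i,j=1,\dots,n$, $i\neq j$. The set $\mathcal Q_S$ of focal points of the secant map is $$\mathcal Q_S=\bigcup_{\substack{i,j=1,\dots,n\\ i\ne j}}\{Q_{i,j}\}.$$ (d) Each focal point belongs to the common boundary of all basins of attraction, that is, for all $i\neq j$, $$Q_{i,j}\in\bigcap_{\ell=1,\dots,n}\partial A(\alpha_\ell).$$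
   Context: Write $p(x)=\sum_{j=0}^k a_jx^j$ with $a_k=1$. Let $q(x,y)=\sum_{j=1}^k a_j\,(x^{j-1}+x^{j-2}y+\dots+xy^{j-2}+y^{j-1})$, the polynomial with $p(x)-p(y)=(x-y)q(x,y)$. Set $\delta_S=\{(x,y)\in\mathbb R^2: x\ne y,\ p(x)=p(y)\}\cup\{(x,x)\in\mathbb R^2: p'(x)=0\}$, which equals $\{q=0\}$. The (real) secant map is $$S(x,y)=\left(y,\ y-p(y)\frac{y-x}{p(y)-p(x)}\right),$$ understood on $\mathbb R^2\setminus\delta_S$ (including diagonal points) as $S(x,y)=\left(y,\frac{N(x,y)}{D(x,y)}\right)$ with $N(x,y)=y\,q(x,y)-p(y)$ and $D(x,y)=q(x,y)$. Set $E_S=\mathbb R^2\setminus\bigcup_{m\ge0}S^{-m}(\delta_S)$, i.e. the set of points for which all iterates of $S$ are defined. "$S$ induces a smooth dynamical system on $E_S$" means that $S(E_S)\subset E_S$ and that $S:E_S\to E_S$ is the restriction of a $C^\infty$ map defined on the open set $\mathbb R^2\setminus\delta_S$. A fixed point $P$ is attracting if there is $\varepsilon>0$ such that $S^m(y)\to P$ as $m\to\infty$ for all $y\in E_S$ with $|y-P|<\varepsilon$. The basin of attraction is $A(\alpha_\ell)=\{y\in E_S: S^m(y)\to(\alpha_\ell,\alpha_\ell)\text{ as }m\to\infty\}$, and the immediate basin $A^\star(\alpha_\ell)$ is the connected component of $A(\alpha_\ell)$ containing $(\alpha_\ell,\alpha_\ell)$. $\partial$ denotes the topological boundary in $\mathbb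 R^2$. A point $Q\in\delta_S$ is a focal point of $S$ if $N(Q)=D(Q)=0$ and there is a smooth simple arc $\gamma:(-\varepsilon,\varepsilon)\to\mathbb R^2$ with $\gamma(0)=Q$ (and $D(\gamma(t))\neq0$ for $t\ne0$, so that the quotient makes sense) such that $\lim_{t\to0}N(\gamma(t))/D(\gamma(t))$ exists and is finite. *)

theory Defs
  imports "HOL-Analysis.Analysis" "HOL-Computational_Algebra.Polynomial"
begin

section \<open>Smooth maps\<close>

text \<open>
  The predicate \<open>Ck_on n S f\<close> is meant for open \<open>S\<close> and a finite-dimensional domain of \<open>f\<close>; it
  then says that \<open>f\<close> is of class \<open>C\<^sup>n\<close> on \<open>S\<close>, phrased via iterated directional derivatives.
\<close>

primrec Ck_on ::
  "nat \<Rightarrow> 'a::real_normed_vector set \<Rightarrow> ('a \<Rightarrow> 'b::real_normed_vector) \<Rightarrow> bool" where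
  "Ck_on 0 S f \<longleftrightarrow> continuous_on S f"
| "Ck_on (Suc n) S f \<longleftrightarrow>
     (\<forall>x\<in>S. f differentiable (at x)) \<and> (\<forall>v. Ck_on n S (\<lambda>x. frechet_derivative f (at x) v))"

definition Cinf_on ::
  "'a::real_normed_vector set \<Rightarrow> ('a \<Rightarrow> 'b::real_normed_vector) \<Rightarrow> bool" where
  "Cinf_on S f \<longleftrightarrow> open S \<and> (\<forall>n. Ck_on n S f)"

text \<open>A smooth arc is understood to be regularly parametrized, i.e. with nowhere vanishing velocity.\<close>

definition smooth_simple_arc :: "real \<Rightarrow> (real \<Rightarrow> real \<times> real) \<Rightarrow> bool" where
  "smooth_simple_arc \<epsilon> \<gamma> \<longleftrightarrow>
     Cinf_on {-\<epsilon><..<\<epsilon>} \<gamma> \<and> inj_on \<gamma> {-\<epsilon><..<\<epsilon>} \<and>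
     (\<forall>t\<in>{-\<epsilon><..<\<epsilon>}. vector_derivative \<gamma> (at t) \<noteq> 0)"


section \<open>The secant map of a real polynomial\<close>

definition secant_q :: "real poly \<Rightarrow> real \<Rightarrow> real \<Rightarrow> real" where
  "secant_q p x y = (\<Sum>j=1..degree p. coeff p j * (\<Sum>i<j. x ^ (j - 1 - i) * y ^ i))"

definition secant_N :: "real poly \<Rightarrow> real \<times> real \<Rightarrow> real" where
  "secant_N p = (\<lambda>(x, y). y * secant_q p x y - poly p y)"

definition secant_D :: "real poly \<Rightarrow> real \<times> real \<Rightarrow> real" where
  "secant_D p = (\<lambda>(x, y). secant_q p x y)"

definition secant_delta :: "real poly \<Rightarrow> (real \<times> real) set" where
  "secant_delta p =
     {(x, y) | x y. x \<noteq> y \<and> poly p x = poly p y} \<union> {(x, x) | x. poly (pderiv p) x = 0}"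

text \<open>
  The map below is total, but it is meaningful only off \<open>secant_delta p\<close>; on that set the
  denominator vanishes and the value is the junk value \<open>(y, 0)\<close>.
\<close>

definition secant_map :: "real poly \<Rightarrow> real \<times> real \<Rightarrow> real \<times> real" where
  "secant_map p z = (snd z, secant_N p z / secant_D p z)"

text \<open>
  Junk values do no harm here: if some iterate of the total map lies in \<open>secant_delta p\<close>, then the
  first such iterate is reached through genuine values only.  Hence the union of the total preimages
  equals the union of the preimages under the partially defined map.
\<close>

definition secant_E :: "real poly \<Rightarrow> (real \<times> real) set" where
  "secant_E p = UNIV - (\<Union>m. (secant_map p ^^ m) -` secant_delta p)"

definition secant_induces_smooth_dynamics :: "real poly \<Rightarrow> bool" where
  "secant_induces_smooth_dynamics p \<longleftrightarrow>
     secant_map p ` secant_E p \<subseteq> secant_E p \<and>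
     secant_E p \<subseteq> UNIV - secant_delta p \<and>
     Cinf_on (UNIV - secant_delta p) (secant_map p)"

definition secant_fixed_points :: "real poly \<Rightarrow> (real \<times> real) set" where
  "secant_fixed_points p = {z \<in> UNIV - secant_delta p. secant_map p z = z}"

definition secant_attracting :: "real poly \<Rightarrow> real \<times> real \<Rightarrow> bool" where
  "secant_attracting p P \<longleftrightarrow>
     (\<exists>\<epsilon>>0. \<forall>y\<in>secant_E p. norm (y - P) < \<epsilon> \<longrightarrow> (\<lambda>m. (secant_map p ^^ m) y) \<longlonglongrightarrow> P)"

definition secant_basin :: "real poly \<Rightarrow> real \<Rightarrow> (real \<times> real) set" where
  "secant_basin p a = {y \<in> secant_E p. (\<lambda>m. (secant_map p ^^ m) y) \<longlonglongrightarrow> (a, a)}"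

definition secant_immediate_basin :: "real poly \<Rightarrow> real \<Rightarrow> (real \<times> real) set" where
  "secant_immediate_basin p a = connected_component_set (secant_basin p a) (a, a)"

definition secant_focal_points :: "real poly \<Rightarrow> (real \<times> real) set" where
  "secant_focal_points p =
     {Q \<in> secant_delta p. secant_N p Q = 0 \<and> secant_D p Q = 0 \<and>
        (\<exists>\<epsilon>>0. \<exists>\<gamma>. smooth_simple_arc \<epsilon> \<gamma> \<and> \<gamma> 0 = Q \<and>
           (\<forall>t\<in>{-\<epsilon><..<\<epsilon>}. t \<noteq> 0 \<longrightarrow> secant_D p (\<gamma> t) \<noteq> 0) \<and>
           (\<exists>L::real. ((\<lambda>t. secant_N p (\<gamma> t) / secant_D p (\<gamma> t)) \<longlongrightarrow> L) (at 0)))}"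


section \<open>Agreement with the other descriptions of the same objects\<close>

lemma secant_q_diff: "poly p x - poly p y = (x - y) * secant_q p x y"
proof -
  have "poly p x - poly p y = (\<Sum>j\<le>degree p. coeff p j * (x ^ j - y ^ j))"
    by (simp add: poly_altdef sum_subtractf algebra_simps)
  also have "\<dots> = (\<Sum>j=1..degree p. coeff p j * (x ^ j - y ^ j))"
    by (rule sum.mono_neutral_right) (auto simp: not_less_eq_eq)
  also have "\<dots> = (\<Sum>j=1..degree p. coeff p j * ((x - y) * (\<Sum>i<j. x ^ (j - 1 - i) * y ^ i)))"
  proof (rule sum.cong)
    fix j
    have "y ^ j - x ^ j = (y - x) * (\<Sum>i<j. x ^ (j - Suc i) * y ^ i)"
      by (rule power_diff_sumr2)
    then have "x ^ j - y ^ j = (x - y) * (\<Sum>i<j. x ^ (j - 1 - i) * y ^ i)"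
      by (simp add: algebra_simps)
    then show "coeff p j * (x ^ j - y ^ j) =
        coeff p j * ((x - y) * (\<Sum>i<j. x ^ (j - 1 - i) * y ^ i))" by simp
  qed simp
  finally show ?thesis
    by (simp add: secant_q_def sum_distrib_left mult.left_commute)
qed

lemma secant_q_diag: "secant_q p x x = poly (pderiv p) x"
proof -
  have "((\<lambda>y. \<Sum>j\<le>degree p. coeff p j * y ^ j) has_real_derivative
      (\<Sum>j\<le>degree p. coeff p j * (real j * x ^ (j - 1)))) (at x)"
    by (auto intro!: derivative_eq_intros sum.cong)
  then have "(poly p has_real_derivative
      (\<Sum>j\<le>degree p. coeff p j * (real j * x ^ (j - 1)))) (at x)"
    by (simp add: poly_altdef[abs_def])
  then have "poly (pderiv p) x = (\<Sum>j\<le>degree p. coeff p j * (real j * x ^ (j - 1)))"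
    using poly_DERIV DERIV_unique by blast
  also have "\<dots> = (\<Sum>j=1..degree p. coeff p j * (real j * x ^ (j - 1)))"
    by (rule sum.mono_neutral_right) (auto simp: not_less_eq_eq)
  also have "\<dots> = secant_q p x x"
    unfolding secant_q_def by (intro sum.cong) (auto simp flip: power_add)
  finally show ?thesis by simp
qed

lemma secant_delta_eq: "secant_delta p = {z. secant_D p z = 0}"
proof -
  have "(x, y) \<in> secant_delta p \<longleftrightarrow> secant_D p (x, y) = 0" for x y
  proof (cases "x = y")
    case True
    then show ?thesis by (simp add: secant_delta_def secant_D_def secant_q_diag)
  next
    case False
    then show ?thesis
      using secant_q_diff[of p x y] by (auto simp: secant_delta_def secant_D_def)
  qed
  then show ?thesis by auto
qed

lemma secant_map_off_diagonal:
  assumes "x \<noteq> y" "poly p x \<noteq> poly p y"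
  shows "secant_map p (x, y) = (y, y - poly p y * ((y - x) / (poly p y - poly p x)))"
proof -
  have *: "poly p y - poly p x = (y - x) * secant_q p x y"
    using secant_q_diff[of p x y] by (simp add: algebra_simps)
  with assms have "secant_q p x y \<noteq> 0" by auto
  with assms show ?thesis
    unfolding * by (simp add: secant_map_def secant_N_def secant_D_def field_simps)
qed

end

theory Submission
  imports Defs
begin

text \<open>
  Orbits that reach a fixed point after at most two steps suffice for the global statements.  If
  \<open>p a = 0\<close>, then \<open>S (x, a) = (a, a)\<close> and \<open>S (a, y) = (y, a)\<close> off \<open>\<delta>\<^sub>S\<close>.  So the horizontal and the
  vertical line through \<open>(a, a)\<close> belong to the basin of \<open>a\<close>, apart from the points whose two
  coordinates are distinct roots, which lie in \<open>\<delta>\<^sub>S\<close>.  The horizontal lines give unbounded basins;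
  the lines of the two neighbouring roots confine the immediate basin of an inner root to a square.
  Near \<open>(a, b)\<close> the basin of a third root \<open>c\<close> is found by solving \<open>p x / (x - c) = p y / (y - c)\<close>:
  the secant through such \<open>x\<close> and \<open>y\<close> meets the axis in \<open>c\<close>, so that \<open>(x, y)\<close> is mapped first to
  \<open>(y, c)\<close> and then to \<open>(c, c)\<close>.
\<close>

section \<open>Smoothness of rational maps\<close>

text \<open>Derivatives depend only on the values near a point, so openness of \<open>S\<close>
  carries the equality of \<open>f\<close> and \<open>g\<close> over to their derivatives and the
  induction closes.\<close>

lemma Ck_on_cong:
  assumes "open S" "\<And>x. x \<in> S \<Longrightarrow> f x = g x" "Ck_on n S f"
  shows "Ck_on n S g"
  using assms(2,3)
proof (induction n arbitrary: f g)
  case 0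
  then show ?case using continuous_on_cong[of S S f g] by simp
next
  case (Suc n)
  have der: "(g has_derivative frechet_derivative f (at x)) (at x)" if "x \<in> S" for x
  proof -
    have "(f has_derivative frechet_derivative f (at x)) (at x)"
      using Suc.prems(2) that by (simp add: frechet_derivative_works)
    then show ?thesis
      using has_derivative_transform_within_open assms(1) that Suc.prems(1) by blast
  qed
  then have eq: "frechet_derivative g (at x) = frechet_derivative f (at x)" if "x \<in> S" for x
    using frechet_derivative_at that by metis
  have "Ck_on n S (\<lambda>x. frechet_derivative g (at x) v)" for v
  proof (rule Suc.IH)
    show "Ck_on n S (\<lambda>x. frechet_derivative f (at x) v)" using Suc.prems(2) by simp
  qed (simp add: eq)
  then show ?case using der by (auto simp: differentiable_def)
qed

text \<open>Uniqueness of derivatives allows \<open>frechet_derivative\<close> to be replaced by any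
  explicit formula.\<close>

lemma Ck_on_SucI:
  assumes "open S" "\<And>x. x \<in> S \<Longrightarrow> (f has_derivative f' x) (at x)"
    "\<And>v. Ck_on n S (\<lambda>x. f' x v)"
  shows "Ck_on (Suc n) S f"
proof -
  have eq: "f' x = frechet_derivative f (at x)" if "x \<in> S" for x
    using assms(2)[OF that] by (rule frechet_derivative_at)
  have "Ck_on n S (\<lambda>x. frechet_derivative f (at x) v)" for v
    using Ck_on_cong[OF assms(1) _ assms(3)[of v]] eq by simp
  then show ?thesis using assms(2) by (auto simp: differentiable_def)
qed

text \<open>A class of functions closed under directional derivatives, so that one induction gives
  smoothness of every order. Members are total; \<open>S\<close> only restricts which of them may be
  inverted.\<close>

inductive_set rational_on :: "'a::real_normed_vector set \<Rightarrow> ('a \<Rightarrow> real) set"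
  for S where
  const: "(\<lambda>x. c) \<in> rational_on S"
| linear: "bounded_linear f \<Longrightarrow> f \<in> rational_on S"
| add: "f \<in> rational_on S \<Longrightarrow> g \<in> rational_on S \<Longrightarrow> (\<lambda>x. f x + g x) \<in> rational_on S"
| mult: "f \<in> rational_on S \<Longrightarrow> g \<in> rational_on S \<Longrightarrow> (\<lambda>x. f x * g x) \<in> rational_on S"
| inverse: "f \<in> rational_on S \<Longrightarrow> (\<And>x. x \<in> S \<Longrightarrow> f x \<noteq> 0) \<Longrightarrow> (\<lambda>x. inverse (f x)) \<in> rational_on S"

lemma rational_on_power: "f \<in> rational_on S \<Longrightarrow> (\<lambda>x. f x ^ n) \<in> rational_on S"
  by (induction n) (simp_all add: rational_on.const rational_on.mult)

lemma rational_on_sum: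
  "(\<And>i. i \<in> I \<Longrightarrow> f i \<in> rational_on S) \<Longrightarrow> (\<lambda>x. \<Sum>i\<in>I. f i x) \<in> rational_on S"
  by (induction I rule: infinite_finite_induct) (simp_all add: rational_on.const rational_on.add)

text \<open>The direction is the first argument of \<open>f'\<close>, so that each directional
  derivative \<open>f' v\<close> is itself a function in the class and can be differentiated
  again.\<close>

lemma rational_on_derivative:
  assumes "f \<in> rational_on S"
  shows "\<exists>f'. (\<forall>x\<in>S. (f has_derivative (\<lambda>v. f' v x)) (at x)) \<and> (\<forall>v. f' v \<in> rational_on S)"
  using assms
proof induction
  case (const c)
  show ?case by (rule exI[of _ "\<lambda>v x. 0"]) (auto intro: rational_on.intros)
next
  case (linear f)
  then show ?case
    by (intro exI[of _ "\<lambda>v x. f v"]) (auto intro: rational_on.intros bounded_linear_imp_has_derivative)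
next
  case (add f g)
  then obtain f' g' where
    "\<forall>x\<in>S. (f has_derivative (\<lambda>v. f' v x)) (at x)" "\<forall>v. f' v \<in> rational_on S"
    "\<forall>x\<in>S. (g has_derivative (\<lambda>v. g' v x)) (at x)" "\<forall>v. g' v \<in> rational_on S" by blast
  then show ?case
    by (intro exI[of _ "\<lambda>v x. f' v x + g' v x"])
      (auto intro: rational_on.intros has_derivative_add)
next
  case (mult f g)
  then obtain f' g' where
    "\<forall>x\<in>S. (f has_derivative (\<lambda>v. f' v x)) (at x)" "\<forall>v. f' v \<in> rational_on S"
    "\<forall>x\<in>S. (g has_derivative (\<lambda>v. g' v x)) (at x)" "\<forall>v. g' v \<in> rational_on S" by blast
  then show ?case using mult.hyps
    by (intro exI[of _ "\<lambda>v x. f x * g' v x + f' v x * g x"] conjI allI ballI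
        rational_on.add rational_on.mult) (auto intro: has_derivative_mult)
next
  case (inverse f)
  then obtain f' where *:
    "\<forall>x\<in>S. (f has_derivative (\<lambda>v. f' v x)) (at x)" "\<forall>v. f' v \<in> rational_on S" by blast
  \<comment> \<open>The sign is written as a constant factor, which turns the derivative into a
    product of members of the class.\<close>
  have "((\<lambda>x. inverse (f x)) has_derivative (\<lambda>v. (- 1) * (inverse (f x) * f' v x * inverse (f x)))) (at x)"
    if "x \<in> S" for x
    using Deriv.has_derivative_inverse[OF inverse.hyps(2)[OF that] *(1)[rule_format, OF that]] by simp
  with *(2) inverse.hyps show ?case
    by (intro exI[of _ "\<lambda>v x. (- 1) * (inverse (f x) * f' v x * inverse (f x))"] conjI allI ballI
        rational_on.mult rational_on.const rational_on.inverse) auto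
qed

lemma rational_on_continuous:
  assumes "f \<in> rational_on S"
  shows "continuous_on S f"
proof -
  obtain f' where "\<forall>x\<in>S. (f has_derivative (\<lambda>v. f' v x)) (at x)"
    using rational_on_derivative[OF assms] by blast
  then show ?thesis
    by (meson continuous_at_imp_continuous_on has_derivative_continuous)
qed

lemma Cinf_on_Pair_rational:
  assumes "open S" "f \<in> rational_on S" "g \<in> rational_on S"
  shows "Cinf_on S (\<lambda>x. (f x, g x))"
proof -
  have "Ck_on n S (\<lambda>x. (f x, g x))" for n
    using assms(2,3)
  proof (induction n arbitrary: f g)
    case (0 f g)
    then show ?case by (simp add: continuous_on_Pair rational_on_continuous)
  next
    case (Suc n f g)
    obtain f' g' where *:
      "\<forall>x\<in>S. (f has_derivative (\<lambda>v. f' v x)) (at x)" "\<forall>v. f' v \<in> rational_on S"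
      "\<forall>x\<in>S. (g has_derivative (\<lambda>v. g' v x)) (at x)" "\<forall>v. g' v \<in> rational_on S"
      using rational_on_derivative[OF Suc.prems(1)] rational_on_derivative[OF Suc.prems(2)] by blast
    show ?case
    proof (rule Ck_on_SucI[OF assms(1)])
      show "((\<lambda>x. (f x, g x)) has_derivative (\<lambda>v. (f' v x, g' v x))) (at x)" if "x \<in> S" for x
        using * that by (intro has_derivative_Pair) auto
      show "Ck_on n S (\<lambda>x. (f' v x, g' v x))" for v
        using * by (intro Suc.IH) auto
    qed
  qed
  then show ?thesis using assms(1) by (simp add: Cinf_on_def)
qed

text \<open>This is the arc used to verify focal points: if \<open>b\<close> is a root, then
  \<open>N / D\<close> equals \<open>b\<close> along it wherever \<open>D\<close> does not
  vanish.\<close>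

lemma horizontal_smooth_simple_arc: "smooth_simple_arc \<epsilon> (\<lambda>t. (a + t, b))"
  unfolding smooth_simple_arc_def
proof (intro conjI ballI)
  show "Cinf_on {- \<epsilon><..<\<epsilon>} (\<lambda>t. (a + t, b))"
    by (intro Cinf_on_Pair_rational rational_on.add rational_on.const rational_on.linear
        bounded_linear_ident open_greaterThanLessThan)
  show "inj_on (\<lambda>t. (a + t, b)) {- \<epsilon><..<\<epsilon>}" by (auto simp: inj_on_def)
  fix t :: real
  have "((\<lambda>t. (a + t, b)) has_vector_derivative (1, 0)) (at t)"
    by (rule has_vector_derivative_Pair) (auto intro!: derivative_eq_intros)
  then show "vector_derivative (\<lambda>t. (a + t, b)) (at t) \<noteq> 0"
    by (simp add: vector_derivative_at zero_prod_def)
qed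

lemma secant_D_rational: "secant_D p \<in> rational_on S"
proof -
  have "secant_D p = (\<lambda>z. \<Sum>j=1..degree p. coeff p j * (\<Sum>i<j. fst z ^ (j - 1 - i) * snd z ^ i))"
    by (auto simp: secant_D_def secant_q_def)
  also have "\<dots> \<in> rational_on S"
    by (intro rational_on_sum rational_on.mult rational_on.const rational_on_power
        rational_on.linear bounded_linear_fst bounded_linear_snd)
  finally show ?thesis .
qed

lemma secant_N_rational: "secant_N p \<in> rational_on S"
proof -
  have "secant_N p = (\<lambda>z. snd z * secant_D p z + (- 1) * (\<Sum>j\<le>degree p. coeff p j * snd z ^ j))"
    by (auto simp: secant_N_def secant_D_def poly_altdef)
  also have "\<dots> \<in> rational_on S"
    by (intro rational_on_sum rational_on.add rational_on.mult rational_on.const rational_on_power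
        rational_on.linear bounded_linear_snd secant_D_rational)
  finally show ?thesis .
qed

lemma continuous_on_secant_D: "continuous_on UNIV (secant_D p)"
  by (intro rational_on_continuous secant_D_rational)

lemma secant_map_smooth: "Cinf_on (UNIV - secant_delta p) (secant_map p)"
proof -
  have "open (- {z. secant_D p z = 0})"
    unfolding open_closed using continuous_on_secant_D
    by (auto intro!: closed_Collect_eq)
  then have op: "open (UNIV - secant_delta p)"
    by (simp add: secant_delta_eq Compl_eq_Diff_UNIV)
  have "Cinf_on (UNIV - secant_delta p) (\<lambda>z. (snd z, secant_N p z * inverse (secant_D p z)))"
    by (intro Cinf_on_Pair_rational op rational_on.mult rational_on.inverse rational_on.linear
        bounded_linear_snd secant_N_rational secant_D_rational) (simp add: secant_delta_eq)
  then show ?thesis by (simp add: secant_map_def[abs_def] divide_inverse)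
qed


section \<open>Orbits of the secant map\<close>

lemma secant_E_iff: "z \<in> secant_E p \<longleftrightarrow> (\<forall>m. (secant_map p ^^ m) z \<notin> secant_delta p)"
  by (auto simp: secant_E_def)

lemma secant_E_step:
  "z \<in> secant_E p \<longleftrightarrow> z \<notin> secant_delta p \<and> secant_map p z \<in> secant_E p"
proof -
  have "(\<forall>m. (secant_map p ^^ m) z \<notin> secant_delta p) \<longleftrightarrow>
      z \<notin> secant_delta p \<and> (\<forall>m. (secant_map p ^^ m) (secant_map p z) \<notin> secant_delta p)"
    by (metis funpow_0 funpow_Suc_right comp_apply not0_implies_Suc)
  then show ?thesis by (simp add: secant_E_iff)
qed

text \<open>Dropping the first term of an orbit does not change its limit. Basin points can thus be
  found by pulling back known ones.\<close>

lemma secant_basin_step: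
  "z \<in> secant_basin p c \<longleftrightarrow> z \<notin> secant_delta p \<and> secant_map p z \<in> secant_basin p c"
proof -
  have "(\<lambda>m. (secant_map p ^^ m) z) \<longlonglongrightarrow> (c, c) \<longleftrightarrow>
      (\<lambda>m. (secant_map p ^^ m) (secant_map p z)) \<longlonglongrightarrow> (c, c)"
    using filterlim_sequentially_Suc[of "\<lambda>m. (secant_map p ^^ m) z" "nhds (c, c)"] by (simp add: funpow_swap1)
  then show ?thesis unfolding secant_basin_def using secant_E_step[of z p] by auto
qed

lemma secant_induces_smooth_dynamics: "secant_induces_smooth_dynamics p"
  unfolding secant_induces_smooth_dynamics_def
proof (intro conjI subsetI)
  show "z \<in> secant_E p" if "z \<in> secant_map p ` secant_E p" for z
    using that secant_E_step[of _ p, THEN iffD1] by auto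
  show "z \<in> UNIV - secant_delta p" if "z \<in> secant_E p" for z
    using that secant_E_step[of z p] by simp
qed (rule secant_map_smooth)

text \<open>The equation says that the secant over \<open>x\<close> and \<open>y\<close>, or the
  tangent if \<open>x = y\<close>, crosses the axis at \<open>c\<close>. The form without division
  covers the diagonal as well.\<close>

lemma secant_map_intercept:
  assumes "secant_q p x y \<noteq> 0" "poly p y = (y - c) * secant_q p x y"
  shows "secant_map p (x, y) = (y, c)"
proof -
  have "secant_N p (x, y) = c * secant_D p (x, y)"
    by (simp add: secant_N_def secant_D_def assms(2) algebra_simps)
  then show ?thesis using assms(1) by (simp add: secant_map_def secant_D_def)
qed

lemma two_roots_in_delta:
  "poly p a = 0 \<Longrightarrow> poly p b = 0 \<Longrightarrow> a \<noteq> b \<Longrightarrow> (a, b) \<in> secant_delta p"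
  by (simp add: secant_delta_def)

lemma basins_disjoint:
  assumes "z \<in> secant_basin p a" "z \<in> secant_basin p b"
  shows "a = b"
proof -
  from assms have "(\<lambda>m. (secant_map p ^^ m) z) \<longlonglongrightarrow> (a, a)" "(\<lambda>m. (secant_map p ^^ m) z) \<longlonglongrightarrow> (b, b)"
    by (auto simp: secant_basin_def)
  from LIMSEQ_unique[OF this] show ?thesis by simp
qed

text \<open>Off \<open>c\<close> both \<open>secant_q p x c\<close> and \<open>poly h x\<close> are
  the quotient of \<open>p x\<close> by \<open>x - c\<close>; at \<open>c\<close> both are the
  derivative of \<open>p\<close>.\<close>

lemma root_factor:
  assumes "poly p c = 0"
  obtains h where "p = [:- c, 1:] * h" "\<And>x. secant_q p x c = poly h x"
proof -
  from assms obtain h where h: "p = [:- c, 1:] * h"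
    by (metis poly_eq_0_iff_dvd dvdE)
  have "secant_q p x c = poly h x" for x
  proof (cases "x = c")
    case True
    have "poly (pderiv p) c = poly h c" unfolding h by (simp only: pderiv_mult) (simp add: pderiv_pCons)
    with True show ?thesis using secant_q_diag by simp
  next
    case False
    have "poly p x - poly p c = (x - c) * poly h x" by (simp add: h algebra_simps)
    with False secant_q_diff[of p x c] show ?thesis by simp
  qed
  with h that show thesis by blast
qed

section \<open>Polynomials with simple real roots: fixed points and lines in the basins\<close>

locale poly_simple_roots =
  fixes p :: "real poly"
  assumes simple: "poly p a = 0 \<Longrightarrow> poly (pderiv p) a \<noteq> 0"
begin

text \<open>On the diagonal \<open>q\<close> is the derivative, nonzero by simplicity of the root;
  elsewhere \<open>p x = (x - b) q(x,b)\<close>.\<close>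

lemma secant_q_root_right_ne_0:
  assumes "poly p b = 0" "poly p x = 0 \<Longrightarrow> x = b"
  shows "secant_q p x b \<noteq> 0"
proof (cases "x = b")
  case True
  then show ?thesis using secant_q_diag[of p b] simple[OF assms(1)] by simp
next
  case False
  then have "poly p x \<noteq> 0" using assms(2) by blast
  then show ?thesis using secant_q_diff[of p x b] assms(1) by auto
qed

text \<open>The first coordinate forces \<open>x = y\<close>; then \<open>N = y q\<close> leaves
  \<open>p y = 0\<close>. Conversely, the tangent at a simple root meets the axis in that
  root.\<close>

lemma fixed_points: "secant_fixed_points p = {(a, a) | a. poly p a = 0}"
proof -
  have "(x, y) \<in> secant_fixed_points p \<longleftrightarrow> x = y \<and> poly p y = 0" for x y
  proof
    assume "(x, y) \<in> secant_fixed_points p"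
    then have q: "secant_q p x y \<noteq> 0" and xy: "x = y"
      and N: "secant_N p (x, y) / secant_q p x y = y"
      by (auto simp: secant_fixed_points_def secant_delta_eq secant_D_def secant_map_def)
    from N have "secant_N p (x, y) = y * secant_q p x y" by (simp only: nonzero_divide_eq_eq[OF q])
    with xy show "x = y \<and> poly p y = 0" by (simp add: secant_N_def)
  next
    assume "x = y \<and> poly p y = 0"
    then show "(x, y) \<in> secant_fixed_points p"
      using secant_q_root_right_ne_0[of y y] secant_map_intercept[of p y y y]
      by (simp add: secant_fixed_points_def secant_delta_eq secant_D_def)
  qed
  then have "z \<in> secant_fixed_points p \<longleftrightarrow> fst z = snd z \<and> poly p (snd z) = 0" for z
    by (metis prod.collapse)
  then show ?thesis by (intro set_eqI) (auto simp: prod_eq_iff)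
qed

lemma diag_in_basin:
  assumes "poly p c = 0"
  shows "(c, c) \<in> secant_basin p c"
proof -
  have "(c, c) \<in> secant_fixed_points p" using assms by (simp add: fixed_points)
  then have fp: "(c, c) \<notin> secant_delta p" "secant_map p (c, c) = (c, c)"
    by (auto simp: secant_fixed_points_def)
  from fp(2) have "(secant_map p ^^ m) (c, c) = (c, c)" for m by (induction m) auto
  with fp(1) show ?thesis by (simp add: secant_basin_def secant_E_iff)
qed

lemma horizontal_in_basin:
  assumes "poly p c = 0" "poly p x = 0 \<Longrightarrow> x = c"
  shows "(x, c) \<in> secant_basin p c"
proof -
  have "secant_q p x c \<noteq> 0" using secant_q_root_right_ne_0 assms .
  then show ?thesis
    using secant_basin_step[of "(x, c)"] secant_map_intercept[of p x c c] diag_in_basin assms(1)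
    by (simp add: secant_delta_eq secant_D_def)
qed

text \<open>The first step leads to \<open>(y, c)\<close> and the second to \<open>(c, c)\<close>.
  The last hypothesis ensures that \<open>(y, c)\<close> is not a pair of distinct roots.\<close>

lemma secant_intercept_in_basin:
  assumes "poly p c = 0" "secant_q p x y \<noteq> 0" "poly p y = (y - c) * secant_q p x y"
    "poly p y = 0 \<Longrightarrow> y = c"
  shows "(x, y) \<in> secant_basin p c"
proof -
  have "(x, y) \<notin> secant_delta p" using assms(2) by (simp add: secant_delta_eq secant_D_def)
  moreover have "(y, c) \<in> secant_basin p c" using horizontal_in_basin assms(1,4) .
  ultimately show ?thesis
    by (subst secant_basin_step) (simp only: secant_map_intercept[OF assms(2,3)] not_False_eq_True simp_thms)
qed

text \<open>Every secant through the root \<open>c\<close> has intercept \<open>c\<close>, and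
  \<open>p y \<noteq> 0\<close> keeps its slope from vanishing.\<close>

lemma vertical_in_basin:
  assumes "poly p c = 0" "poly p y \<noteq> 0"
  shows "(c, y) \<in> secant_basin p c"
proof -
  have eq: "poly p y = (y - c) * secant_q p c y"
    using secant_q_diff[of p c y] assms(1) by (simp add: algebra_simps)
  with assms(2) have "secant_q p c y \<noteq> 0" by auto
  from secant_intercept_in_basin[OF assms(1) this eq] assms(2) show ?thesis by blast
qed

text \<open>A point on a line through \<open>(a, a)\<close> lies in \<delta> or in the basin of
  \<open>a\<close>, and distinct basins are disjoint.\<close>

lemma basin_avoids_root_lines:
  assumes "(x, y) \<in> secant_basin p c" "poly p a = 0" "a \<noteq> c"
  shows "x \<noteq> a" "y \<noteq> a"
proof -
  have nd: "(x, y) \<notin> secant_delta p" using assms(1) secant_basin_step[of "(x, y)" p c] by simp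
  show "y \<noteq> a"
  proof
    assume [simp]: "y = a"
    have "(x, y) \<in> secant_basin p a"
      using horizontal_in_basin[of a x] two_roots_in_delta[of p x a] assms(2) nd by auto
    from basins_disjoint[OF this assms(1)] assms(3) show False by simp
  qed
  show "x \<noteq> a"
  proof
    assume [simp]: "x = a"
    have "poly p y \<noteq> 0"
      using two_roots_in_delta[of p a y] assms(2) nd \<open>y \<noteq> a\<close> by auto
    then have "(x, y) \<in> secant_basin p a"
      using vertical_in_basin[of a y] assms(2) by auto
    from basins_disjoint[OF this assms(1)] assms(3) show False by simp
  qed
qed

text \<open>
  If \<open>p = (X - c) h\<close>, one step multiplies the error \<open>y - c\<close> by \<open>(q(x,y) - h(y)) / q(x,y)\<close>, which
  tends to \<open>0\<close> at \<open>(c, c)\<close> because \<open>q(c,c) = h(c) \<noteq> 0\<close>.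
\<close>

lemma root_attracting:
  assumes "poly p c = 0"
  shows "secant_attracting p (c, c)"
proof -
  obtain h where h: "p = [:- c, 1:] * h" "\<And>x. secant_q p x c = poly h x"
    using root_factor[OF assms] by blast
  define r where "r z = (secant_D p z - poly h (snd z)) / secant_D p z" for z
  have D0: "secant_D p (c, c) \<noteq> 0"
    using secant_q_root_right_ne_0[OF assms, of c] by (simp add: secant_D_def)
  have r0: "r (c, c) = 0" by (simp add: r_def secant_D_def h(2))
  have D: "(secant_D p \<longlongrightarrow> secant_D p (c, c)) (nhds (c, c))"
    using continuous_on_secant_D[of p] by (simp add: continuous_on_eq_continuous_at isCont_def
        tendsto_at_iff_tendsto_nhds)
  moreover have "(snd \<longlongrightarrow> snd (c, c)) (nhds (c, c))"
    by (intro tendsto_snd filterlim_ident)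
  ultimately have "(r \<longlongrightarrow> r (c, c)) (nhds (c, c))"
    unfolding r_def[abs_def] using D0 by (intro tendsto_intros filterlim_ident)
  then have "\<forall>\<^sub>F z in nhds (c, c). norm (r z) < 1 / 2"
    unfolding r0 by (intro order_tendstoD(2)[OF tendsto_norm_zero]) auto
  with tendsto_imp_eventually_ne[OF D D0]
  have "\<forall>\<^sub>F z in nhds (c, c). secant_D p z \<noteq> 0 \<and> \<bar>r z\<bar> < 1 / 2"
    by eventually_elim auto
  then obtain e where e: "e > 0" "\<And>z. dist z (c, c) < e \<Longrightarrow> secant_D p z \<noteq> 0 \<and> \<bar>r z\<bar> < 1 / 2"
    unfolding eventually_nhds_metric by blast
  \<comment> \<open>On this square \<open>D\<close> does not vanish and the error factor
    \<open>r\<close> is below one half, so a step at least halves the error of the second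
    coordinate.\<close>
  have step: "fst (secant_map p z) = snd z" "\<bar>snd (secant_map p z) - c\<bar> \<le> \<bar>snd z - c\<bar> / 2"
    if "\<bar>fst z - c\<bar> < e / 2" "\<bar>snd z - c\<bar> < e / 2" for z
  proof -
    have "dist z (c, c) \<le> \<bar>fst z - c\<bar> + \<bar>snd z - c\<bar>"
      by (cases z) (simp add: dist_Pair_Pair dist_real_def sqrt_sum_squares_le_sum_abs)
    with that e(2)[of z] have z: "secant_D p z \<noteq> 0" "\<bar>r z\<bar> < 1 / 2" by auto
    have "secant_N p z - c * secant_D p z = (snd z - c) * (secant_D p z - poly h (snd z))"
      by (cases z) (simp add: secant_N_def secant_D_def h(1) algebra_simps)
    then have "snd (secant_map p z) - c = (snd z - c) * r z"
      using z(1) by (simp add: secant_map_def r_def field_simps)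
    also have "\<bar>\<dots>\<bar> \<le> \<bar>snd z - c\<bar> * (1 / 2)"
      unfolding abs_mult using z(2) by (intro mult_left_mono) auto
    finally show "\<bar>snd (secant_map p z) - c\<bar> \<le> \<bar>snd z - c\<bar> / 2" by simp
  qed (simp add: secant_map_def)
  have halve: "v < e / 2" if "v \<le> u / 2" "0 \<le> u" "u < e / 2" for u v :: real
    using that by simp
  have "(\<lambda>m. (secant_map p ^^ m) z) \<longlonglongrightarrow> (c, c)" if "norm (z - (c, c)) < e / 2" for z
  proof -
    let ?z = "\<lambda>m. (secant_map p ^^ m) z"
    have start: "\<bar>fst z - c\<bar> < e / 2" "\<bar>snd z - c\<bar> < e / 2"
      using that norm_fst_le[of "fst z - c" "snd z - c"] norm_snd_le[of "snd z - c" "fst z - c"]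
      by (cases z; simp)+
    \<comment> \<open>The strict bound is carried separately, since the geometric bound at
      \<open>m = 0\<close> is only \<open>e / 2\<close>. The first coordinate inherits its bound
      from the previous second coordinate.\<close>
    have *: "\<bar>fst (?z m) - c\<bar> < e / 2 \<and> \<bar>snd (?z m) - c\<bar> \<le> (e / 2) * (1 / 2) ^ m
       \<and> \<bar>snd (?z m) - c\<bar> < e / 2" for m
    proof (induction m)
      case 0
      then show ?case using start by simp
    next
      case (Suc m)
      then have IH: "\<bar>fst (?z m) - c\<bar> < e / 2" "\<bar>snd (?z m) - c\<bar> < e / 2"
        "\<bar>snd (?z m) - c\<bar> \<le> (e / 2) * (1 / 2) ^ m" by blast+
      have "fst (?z (Suc m)) = snd (?z m)" "\<bar>snd (?z (Suc m)) - c\<bar> \<le> \<bar>snd (?z m) - c\<bar> / 2"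
        using step[OF IH(1,2)] by simp_all
      moreover from this(2) have "\<bar>snd (?z (Suc m)) - c\<bar> < e / 2" by (intro halve[OF _ abs_ge_zero IH(2)])
      ultimately show ?case using IH by auto
    qed
    have "(\<lambda>m. (e / 2) * (1 / 2) ^ m) \<longlonglongrightarrow> 0"
      by (intro tendsto_mult_right_zero LIMSEQ_realpow_zero) auto
    then have "(\<lambda>m. snd (?z m) - c) \<longlonglongrightarrow> 0"
      by (rule Lim_null_comparison[rotated]) (use * in auto)
    then have lim: "(\<lambda>m. snd (?z m)) \<longlonglongrightarrow> c" using LIM_zero_iff by blast
    moreover have "(\<lambda>m. fst (?z m)) \<longlonglongrightarrow> c"
    proof (rule LIMSEQ_imp_Suc)
      show "(\<lambda>m. fst (?z (Suc m))) \<longlonglongrightarrow> c" using lim by (simp add: secant_map_def)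
    qed
    ultimately have "(\<lambda>m. (fst (?z m), snd (?z m))) \<longlonglongrightarrow> (c, c)" by (rule tendsto_Pair[rotated])
    then show ?thesis by simp
  qed
  with half_gt_zero[OF e(1)] show ?thesis
    unfolding secant_attracting_def by blast
qed


section \<open>Unbounded and bounded immediate basins\<close>

lemma immediate_basin_subset: "secant_immediate_basin p c \<subseteq> secant_basin p c"
  unfolding secant_immediate_basin_def by (rule connected_component_subset)

lemma segment_in_immediate_basin:
  assumes "poly p c = 0" "connected I" "c \<in> I" "\<And>x. x \<in> I \<Longrightarrow> poly p x = 0 \<Longrightarrow> x = c"
  shows "I \<times> {c} \<subseteq> secant_immediate_basin p c"
  unfolding secant_immediate_basin_def
proof (rule connected_component_maximal)
  show "connected (I \<times> {c})" using assms(2) by (intro connected_Times) auto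
  show "(c, c) \<in> I \<times> {c}" using assms(3) by simp
  show "I \<times> {c} \<subseteq> secant_basin p c"
    using horizontal_in_basin[OF assms(1)] assms(4) by blast
qed

text \<open>No root lies to the left of \<open>c\<close>, so the whole half-line to the left of
  \<open>(c, c)\<close> is mapped to \<open>(c, c)\<close> in one step.\<close>

lemma immediate_basin_unbounded_left:
  assumes "poly p c = 0" "\<And>a. poly p a = 0 \<Longrightarrow> c \<le> a"
  shows "\<not> bounded (secant_immediate_basin p c)"
proof
  assume "bounded (secant_immediate_basin p c)"
  moreover have "{..c} \<times> {c} \<subseteq> secant_immediate_basin p c"
  proof (rule segment_in_immediate_basin[OF assms(1) connected_Iic])
    show "x = c" if "x \<in> {..c}" "poly p x = 0" for x
      using assms(2)[OF that(2)] that(1) by simp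
  qed simp
  ultimately have "bounded ({..c} \<times> {c})" by (rule bounded_subset)
  then have "bounded {..c}" using bounded_fst[of "{..c} \<times> {c}"] by simp
  then obtain B where "\<forall>x\<in>{..c}. \<bar>x\<bar> \<le> B" unfolding bounded_real by blast
  then have "\<bar>min c (- B - 1)\<bar> \<le> B" by simp
  then show False by linarith
qed

lemma immediate_basin_unbounded_right:
  assumes "poly p c = 0" "\<And>a. poly p a = 0 \<Longrightarrow> a \<le> c"
  shows "\<not> bounded (secant_immediate_basin p c)"
proof
  assume "bounded (secant_immediate_basin p c)"
  moreover have "{c..} \<times> {c} \<subseteq> secant_immediate_basin p c"
  proof (rule segment_in_immediate_basin[OF assms(1) connected_Ici])
    show "x = c" if "x \<in> {c..}" "poly p x = 0" for x
      using assms(2)[OF that(2)] that(1) by simp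
  qed simp
  ultimately have "bounded ({c..} \<times> {c})" by (rule bounded_subset)
  then have "bounded {c..}" using bounded_fst[of "{c..} \<times> {c}"] by simp
  then obtain B where "\<forall>x\<in>{c..}. \<bar>x\<bar> \<le> B" unfolding bounded_real by blast
  then have "\<bar>max c (B + 1)\<bar> \<le> B" by simp
  then show False by linarith
qed

lemma immediate_basin_bounded:
  assumes "poly p a = 0" "poly p b = 0" "poly p c = 0" "a < c" "c < b"
  shows "bounded (secant_immediate_basin p c)"
proof -
  let ?U = "secant_immediate_basin p c"
  have conn: "connected ?U" unfolding secant_immediate_basin_def by (rule connected_connected_component)
  have cU: "(c, c) \<in> ?U"
    unfolding secant_immediate_basin_def using diag_in_basin[OF assms(3)] by simp
  \<comment> \<open>For a coordinate \<open>f\<close>, the image of the connected set is an interval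
    containing \<open>c\<close>; to leave \<open>{a..b}\<close> it would have to contain
    \<open>a\<close> or \<open>b\<close>.\<close>
  have box: "f ` ?U \<subseteq> {a..b}"
    if "continuous_on ?U f" "f (c, c) = c" "\<And>z. z \<in> ?U \<Longrightarrow> f z \<noteq> a \<and> f z \<noteq> b" for f
  proof -
    have "is_interval (f ` ?U)"
      using connected_continuous_image[OF that(1) conn] is_interval_connected_1 by blast
    moreover have "c \<in> f ` ?U" using cU that(2) by force
    ultimately have "a \<in> f ` ?U \<or> b \<in> f ` ?U" if "u \<in> f ` ?U" "u \<notin> {a..b}" for u
      using that assms(4,5) unfolding is_interval_1
      by (metis atLeastAtMost_iff less_eq_real_def linorder_not_le)
    with that(3) show ?thesis by blast
  qed
  have avoid: "fst z \<noteq> d" "snd z \<noteq> d" if "z \<in> ?U" "d = a \<or> d = b" for z d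
    using basin_avoids_root_lines[of "fst z" "snd z" c d] immediate_basin_subset that assms by auto
  have "fst ` ?U \<subseteq> {a..b}" "snd ` ?U \<subseteq> {a..b}"
    by (intro box continuous_on_fst continuous_on_snd continuous_on_id; use avoid in auto)+
  then have "?U \<subseteq> {a..b} \<times> {a..b}" by force
  then show ?thesis by (rule bounded_subset[rotated]) (simp add: bounded_Times)
qed

text \<open>The horizontal line of \<open>c\<close> lies in the basin up to finitely many points,
  and a line without finitely many points is unbounded.\<close>

lemma basin_unbounded:
  assumes "p \<noteq> 0" "poly p c = 0"
  shows "\<not> bounded (secant_basin p c)"
proof
  assume "bounded (secant_basin p c)"
  moreover have "{x. poly p x \<noteq> 0} \<times> {c} \<subseteq> secant_basin p c"
    using assms(2) horizontal_in_basin by auto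
  ultimately have "bounded ({x. poly p x \<noteq> 0} \<times> {c})" by (rule bounded_subset)
  then have "bounded {x. poly p x \<noteq> 0}"
    using bounded_fst[of "{x. poly p x \<noteq> 0} \<times> {c}"] by simp
  moreover have "bounded {x. poly p x = 0}"
    using poly_roots_finite[OF assms(1)] by (rule finite_imp_bounded)
  moreover have "UNIV = {x. poly p x \<noteq> 0} \<union> {x. poly p x = 0}" by auto
  ultimately have "bounded (UNIV :: real set)" by (metis bounded_Un)
  then show False by simp
qed


section \<open>Focal points\<close>

text \<open>From \<open>N = D = 0\<close> follows \<open>p b = 0\<close>, and a zero of
  \<open>q\<close> on the horizontal line of \<open>b\<close> has another root as first coordinate.
  Conversely \<open>p b = 0\<close> gives \<open>N = b D\<close>, so the quotient is constant on a
  horizontal arc.\<close>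

lemma focal_points:
  assumes "p \<noteq> 0"
  shows "secant_focal_points p = {(a, b) | a b. poly p a = 0 \<and> poly p b = 0 \<and> a \<noteq> b}"
proof (intro equalityI subsetI)
  fix Q assume Q: "Q \<in> secant_focal_points p"
  obtain a b where [simp]: "Q = (a, b)" by (cases Q)
  from Q have q: "secant_q p a b = 0" "poly p b = 0"
    by (auto simp: secant_focal_points_def secant_N_def secant_D_def)
  with secant_q_root_right_ne_0[of b a] show
    "Q \<in> {(a, b) | a b. poly p a = 0 \<and> poly p b = 0 \<and> a \<noteq> b}" by auto
next
  fix Q assume "Q \<in> {(a, b) | a b. poly p a = 0 \<and> poly p b = 0 \<and> a \<noteq> b}"
  then obtain a b where Q: "Q = (a, b)" and ab: "poly p a = 0" "poly p b = 0" "a \<noteq> b" by blast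
  have del: "(a, b) \<in> secant_delta p" using two_roots_in_delta ab .
  then have D: "secant_D p (a, b) = 0" by (simp add: secant_delta_eq)
  then have N: "secant_N p (a, b) = 0" using ab by (simp add: secant_N_def secant_D_def)
  have "finite ({x. poly p x = 0} - {a})" using poly_roots_finite[OF assms] by simp
  then have "open (- ({x. poly p x = 0} - {a}))" using finite_imp_closed open_Compl by blast
  \<comment> \<open>The radius excludes all roots other than \<open>a\<close>, so that
    \<open>D\<close> vanishes on the arc only at \<open>t = 0\<close>.\<close>
  then obtain e where e: "e > 0" "ball a e \<subseteq> - ({x. poly p x = 0} - {a})"
    unfolding open_contains_ball by blast
  have ne: "secant_D p (a + t, b) \<noteq> 0" if "t \<in> {-e<..<e}" "t \<noteq> 0" for t
  proof -
    have "a + t \<in> ball a e" using that(1) by (auto simp: dist_real_def)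
    with e(2) that(2) have "poly p (a + t) \<noteq> 0" by auto
    then show ?thesis using secant_q_root_right_ne_0[of b "a + t"] ab(2) by (simp add: secant_D_def)
  qed
  have "\<forall>\<^sub>F t in at 0. secant_N p (a + t, b) / secant_D p (a + t, b) = b"
    unfolding eventually_at
  proof (intro exI[of _ e] conjI ballI impI)
    fix t :: real assume "t \<noteq> 0 \<and> dist t 0 < e"
    then have "secant_D p (a + t, b) \<noteq> 0" by (intro ne) auto
    then show "secant_N p (a + t, b) / secant_D p (a + t, b) = b"
      using ab(2) by (simp add: secant_N_def secant_D_def)
  qed (rule e(1))
  then have "((\<lambda>t. secant_N p (a + t, b) / secant_D p (a + t, b)) \<longlongrightarrow> b) (at 0)"
    by (rule tendsto_eventually)
  then have lim: "\<exists>L. ((\<lambda>t. secant_N p (a + t, b) / secant_D p (a + t, b)) \<longlongrightarrow> L) (at 0)"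
    by blast
  show "Q \<in> secant_focal_points p"
    unfolding secant_focal_points_def Q mem_Collect_eq
  proof (intro conjI del D N, rule exI[of _ e], rule conjI[OF e(1)], rule exI[of _ "\<lambda>t. (a + t, b)"],
      intro conjI horizontal_smooth_simple_arc lim)
    show "\<forall>t\<in>{-e<..<e}. t \<noteq> 0 \<longrightarrow> secant_D p (a + t, b) \<noteq> 0" using ne by blast
  qed auto
qed

section \<open>Frontiers of the basins\<close>

text \<open>Near the simple root \<open>a\<close> the map \<open>h\<close> is open, so it takes all
  small values there. For \<open>y \<noteq> b\<close> close to \<open>b\<close>, \<open>h y\<close>
  is such a value, and it is nonzero because zeros are isolated.\<close>

lemma common_small_value:
  fixes h :: "real poly"
  assumes "poly h a = 0" "poly h b = 0" "poly (pderiv h) a \<noteq> 0" "e > 0"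
  obtains x y where "\<bar>x - a\<bar> < e" "\<bar>y - b\<bar> < e" "poly h x = poly h y" "poly h y \<noteq> 0"
proof -
  have "poly h a \<in> interior (poly h ` ball a e)"
  proof (rule sussmann_open_mapping[OF open_UNIV])
    show "continuous_on UNIV (poly h)" by (intro continuous_intros)
    show "(poly h has_derivative (*) (poly (pderiv h) a)) (at a)"
      using poly_DERIV[of h a] by (simp add: has_field_derivative_def)
    show "bounded_linear (\<lambda>v. v / poly (pderiv h) a)" by (rule bounded_linear_divide)
    show "(*) (poly (pderiv h) a) \<circ> (\<lambda>v. v / poly (pderiv h) a) = id"
      using assms(3) by (auto simp: o_def id_def)
  qed (use assms(4) in auto)
  then have "\<forall>\<^sub>F v in nhds (poly h b). v \<in> interior (poly h ` ball a e)"
    using assms(1,2) by (intro eventually_nhds_in_open) auto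
  moreover have "filterlim (poly h) (nhds (poly h b)) (at b)"
    using poly_isCont isCont_def by blast
  ultimately have "\<forall>\<^sub>F y in at b. poly h y \<in> interior (poly h ` ball a e)"
    by (auto simp: filterlim_iff)
  moreover have "\<forall>\<^sub>F y in at b. poly h y \<noteq> 0"
  proof -
    have "h \<noteq> 0" using assms(3) by auto
    then have "finite {y. poly h y = 0}" by (rule poly_roots_finite)
    then have "\<not> b islimpt {y. poly h y = 0}" by (rule islimpt_finite)
    then show ?thesis by (simp add: islimpt_iff_eventually)
  qed
  moreover have "\<forall>\<^sub>F y in at b. dist y b < e"
    using assms(4) by (auto simp: eventually_at)
  ultimately have "\<forall>\<^sub>F y in at b. poly h y \<in> poly h ` ball a e \<and> poly h y \<noteq> 0 \<and> dist y b < e"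
    by eventually_elim (use interior_subset in blast)
  then obtain y where "poly h y \<in> poly h ` ball a e" "poly h y \<noteq> 0" "dist y b < e"
    using eventually_happens'[OF at_neq_bot] by blast
  then show thesis using that by (force simp: dist_real_def)
qed

lemma focal_in_frontier:
  assumes "p \<noteq> 0" "poly p a = 0" "poly p b = 0" "poly p c = 0" "a \<noteq> b"
  shows "(a, b) \<in> frontier (secant_basin p c)"
proof -
  have "(a, b) \<notin> secant_basin p c"
    using two_roots_in_delta[OF assms(2,3,5)] secant_basin_step[of "(a, b)" p c] by simp
  moreover have "(a, b) \<in> closure (secant_basin p c)"
    unfolding closure_approachable
  proof (intro allI impI)
    fix e :: real assume e: "e > 0"
    have near: "\<exists>y. \<bar>y - d\<bar> < e \<and> poly p y \<noteq> 0" for d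
    proof -
      have "\<forall>\<^sub>F y in at d. poly p y \<noteq> 0"
        using islimpt_finite[OF poly_roots_finite[OF assms(1)], of d]
        by (simp add: islimpt_iff_eventually)
      moreover have "\<forall>\<^sub>F y in at d. dist y d < e"
        using e by (auto simp: eventually_at)
      ultimately have "\<forall>\<^sub>F y in at d. \<bar>y - d\<bar> < e \<and> poly p y \<noteq> 0"
        by eventually_elim (simp add: dist_real_def)
      then show ?thesis using eventually_happens'[OF at_neq_bot] by blast
    qed
    consider "c = a" | "c = b" | "c \<noteq> a" "c \<noteq> b" by blast
    then show "\<exists>z\<in>secant_basin p c. dist z (a, b) < e"
    proof cases
      case 1
      obtain y where "\<bar>y - b\<bar> < e" "poly p y \<noteq> 0" using near by blast
      then show ?thesis using vertical_in_basin[of a y] assms(2) 1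
        by (intro bexI[of _ "(a, y)"]) (auto simp: dist_Pair_Pair dist_real_def)
    next
      case 2
      obtain x where "\<bar>x - a\<bar> < e" "poly p x \<noteq> 0" using near by blast
      then show ?thesis using horizontal_in_basin[of b x] assms(3) 2
        by (intro bexI[of _ "(x, b)"]) (auto simp: dist_Pair_Pair dist_real_def)
    next
      case 3
      obtain h where h: "p = [:- c, 1:] * h" using root_factor[OF assms(4)] by blast
      \<comment> \<open>Since \<open>h x\<close> is the quotient of \<open>p x\<close> by
        \<open>x - c\<close>, points with \<open>h x = h y\<close> are those whose secant aims at
        \<open>c\<close>; both \<open>a\<close> and \<open>b\<close> remain roots of
        \<open>h\<close>.\<close>
      have h0: "poly h a = 0" "poly h b = 0" using assms(2,3) 3 by (auto simp: h)
      have "poly (pderiv p) a = (a - c) * poly (pderiv h) a"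
        using h0 unfolding h by (simp only: pderiv_mult) (simp add: pderiv_pCons algebra_simps)
      then have "poly (pderiv h) a \<noteq> 0" using simple[OF assms(2)] by auto
      \<comment> \<open>The three bounds serve in turn for distance below \<open>e\<close>, for
        \<open>x \<noteq> y\<close> and for \<open>y \<noteq> c\<close>.\<close>
      moreover define d where "d = min (e / 2) (min (\<bar>a - b\<bar> / 2) \<bar>b - c\<bar>)"
      moreover have "d > 0" using e assms(5) 3 by (auto simp: d_def)
      ultimately obtain x y where xy: "\<bar>x - a\<bar> < d" "\<bar>y - b\<bar> < d"
        "poly h x = poly h y" "poly h y \<noteq> 0"
        using common_small_value h0 by metis
      have bounds: "2 * \<bar>x - a\<bar> < \<bar>a - b\<bar>" "2 * \<bar>y - b\<bar> < \<bar>a - b\<bar>" "\<bar>y - b\<bar> < \<bar>b - c\<bar>"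
        using xy(1,2) by (simp_all add: d_def)
      have "x \<noteq> y"
      proof
        assume "x = y"
        then have "\<bar>a - b\<bar> \<le> \<bar>x - a\<bar> + \<bar>y - b\<bar>" by simp
        with bounds(1,2) show False by simp
      qed
      have "y \<noteq> c" using bounds(3) by auto
      \<comment> \<open>With the common value \<open>v\<close> of \<open>h\<close>, the difference
        of \<open>p x = (x - c) v\<close> and \<open>p y = (y - c) v\<close> is
        \<open>(x - y) v\<close>; hence the slope is \<open>v\<close>, which is nonzero.\<close>
      have "(x - y) * secant_q p x y = (x - y) * poly h y"
        using secant_q_diff[of p x y] xy(3) by (simp add: h algebra_simps)
      then have q: "secant_q p x y = poly h y" using \<open>x \<noteq> y\<close> by simp
      have "(x, y) \<in> secant_basin p c"
        using xy(4) \<open>y \<noteq> c\<close> by (intro secant_intercept_in_basin) (auto simp: assms(4) q, auto simp: h algebra_simps)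
      moreover have "dist (x, y) (a, b) < e"
      proof -
        have "dist (x, y) (a, b) \<le> \<bar>x - a\<bar> + \<bar>y - b\<bar>"
          by (simp add: dist_Pair_Pair dist_real_def sqrt_sum_squares_le_sum_abs)
        with xy(1,2) show ?thesis by (simp add: d_def)
      qed
      ultimately show ?thesis by blast
    qed
  qed
  ultimately show ?thesis unfolding frontier_def using interior_subset by blast
qed

end

theorem theoremA:
  fixes p :: "real poly" and k n :: nat and \<alpha> :: "nat \<Rightarrow> real"
  assumes "lead_coeff p = 1"
    and "degree p = k" and "k \<ge> 2"
    and "1 \<le> n" and "n \<le> k"
    and "strict_mono_on {1..n} \<alpha>"
    and "{x. poly p x = 0} = \<alpha> ` {1..n}"
    and "\<forall>l\<in>{1..n}. order (\<alpha> l) p = 1"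
  shows "secant_induces_smooth_dynamics p
    \<and> (secant_fixed_points p = {(\<alpha> l, \<alpha> l) | l. l \<in> {1..n}}
        \<and> (\<forall>l\<in>{1..n}. secant_attracting p (\<alpha> l, \<alpha> l)))
    \<and> ((\<forall>l\<in>{1..n}. \<not> bounded (secant_basin p (\<alpha> l)))
        \<and> (n = 1 \<longrightarrow> \<not> bounded (secant_immediate_basin p (\<alpha> 1)))
        \<and> (n = 2 \<longrightarrow> \<not> bounded (secant_immediate_basin p (\<alpha> 1))
                  \<and> \<not> bounded (secant_immediate_basin p (\<alpha> 2)))
        \<and> (n \<ge> 3 \<longrightarrow> \<not> bounded (secant_immediate_basin p (\<alpha> 1))
                  \<and> \<not> bounded (secant_immediate_basin p (\<alpha> n))
                  \<and> (\<forall>l\<in>{2..n - 1}. bounded (secant_immediate_basin p (\<alpha> l)))))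
    \<and> secant_focal_points p =
        (\<Union>(i, j)\<in>{(i, j). i \<in> {1..n} \<and> j \<in> {1..n} \<and> i \<noteq> j}. {(\<alpha> i, \<alpha> j)})
    \<and> (\<forall>i\<in>{1..n}. \<forall>j\<in>{1..n}. i \<noteq> j \<longrightarrow>
          (\<alpha> i, \<alpha> j) \<in> (\<Inter>l\<in>{1..n}. frontier (secant_basin p (\<alpha> l))))"
proof -
  have p0: "p \<noteq> 0" using assms(1) by auto
  have root: "poly p a = 0 \<longleftrightarrow> a \<in> \<alpha> ` {1..n}" for a using assms(7) by blast
  interpret poly_simple_roots p
  proof
    fix a assume a: "poly p a = 0"
    then have "order a p = 1" using root assms(8) by auto
    show "poly (pderiv p) a \<noteq> 0"
    proof
      assume d: "poly (pderiv p) a = 0"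
      have "pderiv p \<noteq> 0" using assms(2,3) by (simp add: pderiv_eq_0_iff)
      then have "order a (pderiv p) \<noteq> 0" using d by (simp add: order_root)
      \<comment> \<open>A root of \<open>p\<close> and of its derivative would have order at least
        two, as differentiation lowers the order by one.\<close>
      then show False using \<open>order a p = 1\<close> order_pderiv[of p a] \<open>pderiv p \<noteq> 0\<close> a p0
        by (simp add: order_root)
    qed
  qed
  have rt: "poly p (\<alpha> l) = 0" if "l \<in> {1..n}" for l using root that by blast
  have less: "\<alpha> i < \<alpha> j" if "i \<in> {1..n}" "j \<in> {1..n}" "i < j" for i j
    using assms(6) that by (auto simp: strict_mono_on_def)
  have le: "\<alpha> i \<le> \<alpha> j" if "i \<in> {1..n}" "j \<in> {1..n}" "i \<le> j" for i j
    using less[of i j] that by (cases "i = j") auto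
  have inj: "\<alpha> i = \<alpha> j \<longleftrightarrow> i = j" if "i \<in> {1..n}" "j \<in> {1..n}" for i j
    using less[of i j] less[of j i] that by (metis less_irrefl linorder_neqE_nat)
  have first: "\<not> bounded (secant_immediate_basin p (\<alpha> 1))"
  proof (rule immediate_basin_unbounded_left)
    show "poly p (\<alpha> 1) = 0" using rt assms(4) by simp
    show "\<alpha> 1 \<le> a" if "poly p a = 0" for a
      using that le[of 1] assms(4) unfolding root by auto
  qed
  have last: "\<not> bounded (secant_immediate_basin p (\<alpha> n))"
  proof (rule immediate_basin_unbounded_right)
    show "poly p (\<alpha> n) = 0" using rt assms(4) by simp
    show "a \<le> \<alpha> n" if "poly p a = 0" for a
      using that le[of _ n] assms(4) unfolding root by auto
  qed
  \<comment> \<open>The range of \<open>l\<close> guarantees that both neighbouring roots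
    exist.\<close>
  have inner: "bounded (secant_immediate_basin p (\<alpha> l))" if "l \<in> {2..n - 1}" for l
    using that by (intro immediate_basin_bounded[of "\<alpha> (l - 1)" "\<alpha> (l + 1)"] rt less) auto
  have fixed: "secant_fixed_points p = {(\<alpha> l, \<alpha> l) | l. l \<in> {1..n}}"
    unfolding fixed_points root by blast
  have "secant_focal_points p =
      (\<Union>(i, j)\<in>{(i, j). i \<in> {1..n} \<and> j \<in> {1..n} \<and> i \<noteq> j}. {(\<alpha> i, \<alpha> j)})"
    unfolding focal_points[OF p0] root using inj by auto blast
  moreover have "(\<alpha> i, \<alpha> j) \<in> (\<Inter>l\<in>{1..n}. frontier (secant_basin p (\<alpha> l)))"
    if "i \<in> {1..n}" "j \<in> {1..n}" "i \<noteq> j" for i j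
    using that inj by (auto intro!: focal_in_frontier p0 rt)
  \<comment> \<open>The cases \<open>n = 1\<close> and \<open>n = 2\<close> are instances of
    \<open>first\<close> and \<open>last\<close>.\<close>
  ultimately show ?thesis
    using secant_induces_smooth_dynamics fixed root_attracting rt basin_unbounded[OF p0] first last inner
    by auto
qed

end
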